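(* Let $K$ be an arbitrary field and let $R$ be a finitely generated graded algebra over $K$ which is a PI-algebra. Then the Hilbert series $H(R,t)$ is either a rational function or transcendental over $\mathbb{Q}(t)$.
   Context: Algebras are unitary associative algebras over a field $K$ of any characteristic. A graded algebra is an algebra $R$ that is a direct sum of vector subspaces $R=R_0\oplus R_1\oplus R_2\oplus\cdots$ with $R_mR_n\subset R_{m+n}$ for all $m,n\geq 0$; it is assumed throughout that $R_0=0$ or $R_0=K$ and that the (finitely many) algebra generators of $R$ are of first degree. The Hilbert series of $R$ is the formal power series $H(R,t)=\sum_{n\geq 0}\dim_K(R_n)\,t^n$. A power series is rational if it is the expansion of an element of $\mathbb{Q}(t)$; it is algebraic (respectively transcendental) if it is algebraic (respectively not algebraic) over $\mathbb{Q}(t)$. An element $f(x_1,\ldots,x_n)$ of the free associative algebra $K\langle x_1,x_2,\ldots\rangle$ is a polynomial identity for $R$ if $f(r_1,\ldots,r_n)=0$ for all $r_1,\ldots,r_n\in R$; $R$ is a PI-algebra if it satisfies a nontrivial (i.e. $f\neq 0$) polynomial identity. *)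

theory Defs
  imports
    "HOL-Computational_Algebra.Computational_Algebra"
    "HOL-Library.Poly_Mapping"
begin

section \<open>Expansions of rational functions, algebraic and transcendental power series\<close>

text \<open>
  The field \<open>\<rat>(t)\<close> is \<^typ>\<open>rat poly fract\<close>; it is embedded into the field \<open>\<rat>((t))\<close> of formal
  Laurent series, in which the power series ring \<open>\<rat>[[t]]\<close> lies via \<^const>\<open>fps_to_fls\<close>.
\<close>

definition ratfun_to_fls :: "rat poly fract \<Rightarrow> rat fls" where
  "ratfun_to_fls x =
     (THE y. \<exists>p q. q \<noteq> 0 \<and> x = Fract p q \<and>
        y = fps_to_fls (fps_of_poly p) / fps_to_fls (fps_of_poly q))"

lemma ratfun_to_fls_Fract:
  assumes "q \<noteq> 0"
  shows "ratfun_to_fls (Fract p q) = fps_to_fls (fps_of_poly p) / fps_to_fls (fps_of_poly q)"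
  unfolding ratfun_to_fls_def
proof (rule the_equality)
  show "\<exists>p' q'. q' \<noteq> 0 \<and> Fract p q = Fract p' q' \<and>
          fps_to_fls (fps_of_poly p) / fps_to_fls (fps_of_poly q) =
          fps_to_fls (fps_of_poly p') / fps_to_fls (fps_of_poly q')"
    using assms by blast
next
  fix y
  assume "\<exists>p' q'. q' \<noteq> 0 \<and> Fract p q = Fract p' q' \<and>
            y = fps_to_fls (fps_of_poly p') / fps_to_fls (fps_of_poly q')"
  then obtain p' q' where q': "q' \<noteq> 0" and "Fract p q = Fract p' q'"
    and y: "y = fps_to_fls (fps_of_poly p') / fps_to_fls (fps_of_poly q')" by blast
  hence "p * q' = p' * q" using assms by (simp add: eq_fract)
  hence "fps_to_fls (fps_of_poly p) * fps_to_fls (fps_of_poly q') =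
         fps_to_fls (fps_of_poly p') * fps_to_fls (fps_of_poly q)"
    by (metis fls_times_fps_to_fls fps_of_poly_mult)
  thus "y = fps_to_fls (fps_of_poly p) / fps_to_fls (fps_of_poly q)"
    using assms q' y by (simp add: frac_eq_eq)
qed

lemma ratfun_to_fls_0 [simp]: "ratfun_to_fls 0 = 0"
  using ratfun_to_fls_Fract[of 1 0] by (simp add: Zero_fract_def)

lemma ratfun_to_fls_1 [simp]: "ratfun_to_fls 1 = 1"
  using ratfun_to_fls_Fract[of 1 1] by (simp add: One_fract_def)

lemma ratfun_to_fls_add: "ratfun_to_fls (x + y) = ratfun_to_fls x + ratfun_to_fls y"
  by (cases x; cases y)
     (simp add: ratfun_to_fls_Fract add_frac_eq fps_of_poly_add fps_of_poly_mult
       fls_times_fps_to_fls)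

lemma ratfun_to_fls_mult: "ratfun_to_fls (x * y) = ratfun_to_fls x * ratfun_to_fls y"
  by (cases x; cases y)
     (simp add: ratfun_to_fls_Fract fps_of_poly_mult fls_times_fps_to_fls)

definition rational_fps :: "rat fps \<Rightarrow> bool" where
  "rational_fps f \<longleftrightarrow> fps_to_fls f \<in> range ratfun_to_fls"

definition algebraic_fps :: "rat fps \<Rightarrow> bool" where
  "algebraic_fps f \<longleftrightarrow>
     (\<exists>P :: rat poly fract poly. P \<noteq> 0 \<and> poly (map_poly ratfun_to_fls P) (fps_to_fls f) = 0)"

definition transcendental_fps :: "rat fps \<Rightarrow> bool" where
  "transcendental_fps f \<longleftrightarrow> \<not> algebraic_fps f"


section \<open>Associative algebras and polynomial identities\<close>

text \<open>
  The multiplicative unit is not part of the signature: a graded algebra with zero component of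
  degree 0 has a unit only if it is the zero algebra, and both this case and the unitary case
  are covered. The zero algebra has the unit 0.
\<close>

locale associative_algebra = vector_space scale
  for scale :: "'k::field \<Rightarrow> 'a::ring \<Rightarrow> 'a" (infixr "*s" 75) +
  assumes scale_mult_left: "(c *s x) * y = c *s (x * y)"
    and scale_mult_right: "x * (c *s y) = c *s (x * y)"
begin

definition is_unit_elem :: "'a \<Rightarrow> bool" where
  "is_unit_elem e \<longleftrightarrow> (\<forall>x. e * x = x \<and> x * e = x)"

definition unitary :: bool where
  "unitary \<longleftrightarrow> (\<exists>e. is_unit_elem e)"

definition unit_elem :: 'a where
  "unit_elem = (THE e. is_unit_elem e)"

lemma unit_elem_eq: "is_unit_elem e \<Longrightarrow> unit_elem = e"
  unfolding unit_elem_def by (rule the_equality) (auto simp: is_unit_elem_def, metis)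

definition subalgebra :: "'a set \<Rightarrow> bool" where
  "subalgebra B \<longleftrightarrow>
     subspace B \<and> (\<forall>x\<in>B. \<forall>y\<in>B. x * y \<in> B) \<and> (unitary \<longrightarrow> unit_elem \<in> B)"

definition generated_by :: "'a set \<Rightarrow> bool" where
  "generated_by S \<longleftrightarrow> subalgebra hull S = UNIV"

text \<open>
  An element of the free associative algebra \<open>K\<langle>x\<^sub>0, x\<^sub>1, \<dots>\<rangle>\<close> is a finitely supported
  family of coefficients indexed by words, the word \<open>[i\<^sub>1, \<dots>, i\<^sub>n]\<close> standing for the monomial
  \<open>x\<^bsub>i\<^sub>1\<^esub> \<cdots> x\<^bsub>i\<^sub>n\<^esub>\<close>. The value of the empty word is meaningful only in a unitary algebra; an
  algebra without unit is only evaluated at polynomials without constant term.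
\<close>

primrec eval_word :: "(nat \<Rightarrow> 'a) \<Rightarrow> nat list \<Rightarrow> 'a" where
  "eval_word r [] = unit_elem"
| "eval_word r (i # w) = foldl (\<lambda>x j. x * r j) (r i) w"

definition eval_free :: "(nat \<Rightarrow> 'a) \<Rightarrow> (nat list \<Rightarrow>\<^sub>0 'k) \<Rightarrow> 'a" where
  "eval_free r f = (\<Sum>w\<in>Poly_Mapping.keys f. Poly_Mapping.lookup f w *s eval_word r w)"

definition polynomial_identity :: "(nat list \<Rightarrow>\<^sub>0 'k) \<Rightarrow> bool" where
  "polynomial_identity f \<longleftrightarrow>
     (unitary \<or> Poly_Mapping.lookup f [] = 0) \<and> (\<forall>r. eval_free r f = 0)"

definition PI_algebra :: bool where
  "PI_algebra \<longleftrightarrow> (\<exists>f. f \<noteq> 0 \<and> polynomial_identity f)"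

end


section \<open>Graded algebras and Hilbert series\<close>

locale graded_algebra = associative_algebra scale
  for scale :: "'k::field \<Rightarrow> 'a::ring \<Rightarrow> 'a" (infixr "*s" 75) +
  fixes R :: "nat \<Rightarrow> 'a set"
  assumes subspace_component: "subspace (R n)"
    and direct_sum:
      "\<exists>!c. finite {n. c n \<noteq> 0} \<and> (\<forall>n. c n \<in> R n) \<and> x = (\<Sum>n | c n \<noteq> 0. c n)"
    and mult_component: "x \<in> R m \<Longrightarrow> y \<in> R n \<Longrightarrow> x * y \<in> R (m + n)"
    and component_zero: "R 0 = {0} \<or> (unitary \<and> R 0 = range (\<lambda>c. c *s unit_elem))"
begin

definition finitely_generated_in_degree_one :: bool where
  "finitely_generated_in_degree_one \<longleftrightarrow> (\<exists>S. finite S \<and> S \<subseteq> R 1 \<and> generated_by S)"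

definition Hilbert_series :: "rat fps" where
  "Hilbert_series = Abs_fps (\<lambda>n. of_nat (dim (R n)))"

end

end

theory Submission
  imports
    Defs
    "HOL-Library.Sublist"
    "HOL-Computational_Algebra.Field_as_Ring"
    "HOL-Analysis.FPS_Convergence"
begin

text \<open>
  The proof rests on two facts about the coefficients \<open>a\<^sub>n = dim R\<^sub>n\<close>: they are integers, and they
  grow subexponentially.

  Subexponential growth comes from the polynomial identity. Linearizing it gives an identity that
  rewrites a product \<open>y\<^sub>0 y\<^sub>1 \<cdots> y\<^bsub>d-1\<^esub>\<close> as a linear combination of the products of its factors in
  other orders (\<open>multilinear_identity_exists\<close>). Take any finite family of elements, totally ordered,
  as an alphabet. If a word contains letters \<open>a\<^sub>1 > \<dots> > a\<^sub>d\<close> in this order, cut it before each of them;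
  permuting the pieces makes the word lexicographically smaller. Hence, as in Shirshov's theorem, all
  products of \<open>N\<close> letters are combinations of products along words without a strictly descending
  subsequence of length \<open>d\<close> (\<open>list_mult_in_span_no_descending_chain\<close>). Such a word is a union of fewer
  than \<open>d\<close> weakly increasing subsequences, so over an alphabet of \<open>M\<close> letters there are at most \<open>d\<^sup>N\<close>
  times a polynomial in \<open>N\<close> of them (\<open>card_no_descending_chain_le\<close>). The point is now that the
  exponential factor does not involve \<open>M\<close>: with the products of about \<open>l\<close> generators as letters,
  \<open>R\<^sub>n\<close> is spanned by words of only \<open>n / l\<close> letters, and \<open>a\<^sub>n\<close> is at most \<open>d\<^bsup>n/l\<^esup>\<close> times a polynomial in
  \<open>n\<close>, for every \<open>l\<close> (\<open>PI_growth\<close>). Letting \<open>l\<close> grow shows that the Hilbert series converges in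
  the open unit disc.

  By Fatou, a power series \<open>f\<close> with integer coefficients that converges in the open unit disc and is
  algebraic must be rational (\<open>Fatou_algebraic_imp_rational\<close>). Let \<open>q(t)\<close> be the leading coefficient of
  a polynomial relation for \<open>f\<close> over \<open>\<rat>[t]\<close>. Then \<open>q f\<close> is integral over \<open>\<rat>[t]\<close> and therefore bounded on
  the disc. A power series bounded on the disc has square-summable coefficients, by Parseval's
  identity, and those of \<open>q f\<close> have a common denominator. So all but finitely many of them vanish,
  \<open>q f\<close> is a polynomial, and \<open>f\<close> is rational.
\<close>

section \<open>Multilinear identities\<close>

text \<open>
  The ring may lack a unit, so only products of nonempty lists have a meaning.
\<close>

definition list_mult :: "'a::ring list \<Rightarrow> 'a" where
  "list_mult xs = foldl (*) (hd xs) (tl xs)"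

lemma foldl_mult_assoc: "foldl (*) (x * y) zs = x * foldl (*) (y::'a::ring) zs"
  by (induction zs arbitrary: y) (simp_all add: mult.assoc)

lemma list_mult_append:
  assumes "xs \<noteq> []" "ys \<noteq> []"
  shows "list_mult (xs @ ys) = list_mult xs * list_mult ys"
proof -
  obtain y ys' where "ys = y # ys'" using assms(2) by (cases ys) auto
  thus ?thesis using assms(1)
    by (cases xs) (simp_all add: list_mult_def foldl_mult_assoc)
qed

lemma list_mult_singleton [simp]: "list_mult [x] = x"
  by (simp add: list_mult_def)

lemma list_mult_Cons: "xs \<noteq> [] \<Longrightarrow> list_mult (x # xs) = x * list_mult xs"
  using list_mult_append[of "[x]" xs] by simp

lemma list_mult_concat:
  assumes "xss \<noteq> []" "[] \<notin> set xss"
  shows "list_mult (concat xss) = list_mult (map list_mult xss)"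
  using assms
proof (induction xss)
  case (Cons xs xss)
  show ?case
  proof (cases "xss = []")
    case False
    hence "concat xss \<noteq> []" using Cons.prems by (cases xss) auto
    moreover have "xs \<noteq> []" "[] \<notin> set xss" using Cons.prems by auto
    ultimately show ?thesis
      using False Cons.IH list_mult_append[of xs "concat xss"] by (simp add: list_mult_Cons)
  qed simp
qed simp

lemma list_mult_eq_0: "0 \<in> set xs \<Longrightarrow> list_mult xs = 0"
proof (induction xs)
  case (Cons x xs)
  thus ?case by (cases "xs = []") (auto simp: list_mult_Cons)
qed simp

context associative_algebra
begin

lemma eval_word_eq_list_mult: "w \<noteq> [] \<Longrightarrow> eval_word r w = list_mult (map r w)"
proof (cases w)
  case (Cons i v)
  have "foldl (\<lambda>x j. x * r j) x v = foldl (*) x (map r v)" for x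
    by (induction v arbitrary: x) simp_all
  thus ?thesis using Cons by (simp add: list_mult_def)
qed simp

lemma eval_word_snoc: "eval_word r (w @ [i]) = (if w = [] then r i else eval_word r w * r i)"
  by (cases w) simp_all

text \<open>
  Expanding a product of sums: \<open>\<beta>\<close> distributes the new variables \<open>j \<in> S\<close> over the old ones, and each
  way of choosing one new variable for each factor of \<open>w\<close> is a word \<open>\<phi>\<close> that \<open>\<beta>\<close> maps to \<open>w\<close>.
\<close>

lemma eval_word_sum:
  assumes "finite S"
  shows "eval_word (\<lambda>i. \<Sum>j | j \<in> S \<and> \<beta> j = i. y j) w
           = (\<Sum>\<phi> | set \<phi> \<subseteq> S \<and> map \<beta> \<phi> = w. eval_word y \<phi>)"
proof (induction w rule: rev_induct)
  case Nil
  have "{\<phi>. set \<phi> \<subseteq> S \<and> map \<beta> \<phi> = []} = {[]}" by auto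
  thus ?case by simp
next
  case (snoc i w)
  let ?L = "\<lambda>w. {\<phi>. set \<phi> \<subseteq> S \<and> map \<beta> \<phi> = w}"
  let ?J = "{j. j \<in> S \<and> \<beta> j = i}"
  have L: "?L (w @ [i]) = (\<lambda>(\<phi>, j). \<phi> @ [j]) ` (?L w \<times> ?J)"
  proof (intro equalityI subsetI)
    fix \<phi> assume "\<phi> \<in> ?L (w @ [i])"
    thus "\<phi> \<in> (\<lambda>(\<phi>, j). \<phi> @ [j]) ` (?L w \<times> ?J)"
      by (cases \<phi> rule: rev_cases) auto
  qed auto
  have inj: "inj_on (\<lambda>(\<phi>, j). \<phi> @ [j]) (?L w \<times> ?J)" by (auto simp: inj_on_def)
  have "(\<Sum>\<phi>\<in>?L (w @ [i]). eval_word y \<phi>)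
          = (\<Sum>(\<phi>, j)\<in>?L w \<times> ?J. eval_word y (\<phi> @ [j]))"
    unfolding L by (subst sum.reindex[OF inj]) (simp add: case_prod_unfold)
  also have "\<dots> = (\<Sum>\<phi>\<in>?L w. \<Sum>j\<in>?J. eval_word y (\<phi> @ [j]))"
    by (simp add: sum.cartesian_product)
  also have "\<dots> = eval_word (\<lambda>i. \<Sum>j | j \<in> S \<and> \<beta> j = i. y j) (w @ [i])"
  proof (cases "w = []")
    case True
    have "?L w = {[]}" using True by auto
    thus ?thesis using True by simp
  next
    case False
    have "(\<Sum>\<phi>\<in>?L w. \<Sum>j\<in>?J. eval_word y (\<phi> @ [j]))
            = (\<Sum>\<phi>\<in>?L w. \<Sum>j\<in>?J. eval_word y \<phi> * y j)"
      using False by (intro sum.cong refl) (auto simp: eval_word_snoc)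
    also have "\<dots> = (\<Sum>\<phi>\<in>?L w. eval_word y \<phi>) * (\<Sum>j\<in>?J. y j)"
      by (simp add: sum_product)
    finally show ?thesis using False snoc by (simp add: eval_word_snoc)
  qed
  finally show ?case by simp
qed

text \<open>
  A word \<open>\<phi> \<in> \<Phi>\<close> is a permutation of \<open>0, \<dots>, d - 1\<close> in one-line notation. That the identity permutation
  has a nonzero coefficient is what makes the identity a rewrite rule for the product
  \<open>y\<^sub>0 \<cdots> y\<^bsub>d-1\<^esub>\<close>.
\<close>

definition multilinear_identity :: "nat \<Rightarrow> nat list set \<Rightarrow> (nat list \<Rightarrow> 'k) \<Rightarrow> bool" where
  "multilinear_identity d \<Phi> c \<longleftrightarrow>
     0 < d \<and> finite \<Phi> \<and> (\<forall>\<phi>\<in>\<Phi>. set \<phi> = {..<d} \<and> length \<phi> = d) \<and>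
     [0..<d] \<in> \<Phi> \<and> c [0..<d] \<noteq> 0 \<and>
     (\<forall>y. (\<Sum>\<phi>\<in>\<Phi>. c \<phi> *s eval_word y \<phi>) = 0)"

text \<open>
  Full linearization in one substitution, valid in every characteristic. Let \<open>w0\<close> be a longest
  monomial of the identity, of length \<open>d\<close>, and replace each variable \<open>x\<^sub>i\<close> by the sum of the \<open>y\<^sub>j\<close> over
  the positions \<open>j\<close> of \<open>w0\<close> that carry \<open>i\<close>. Setting \<open>y\<^sub>k\<close> to zero and subtracting leaves the monomials
  that contain \<open>y\<^sub>k\<close>; doing this for all \<open>k < d\<close> leaves those that contain every \<open>y\<^sub>k\<close>. As no monomial
  is longer than \<open>d\<close>, each of these contains every variable exactly once, and
  \<open>y\<^sub>0 \<cdots> y\<^bsub>d-1\<^esub>\<close> arises only from \<open>w0\<close>.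
\<close>

lemma multilinear_identity_exists:
  assumes PI_algebra
  shows "\<exists>d \<Phi> c. multilinear_identity d \<Phi> c"
proof -
  obtain f where f: "f \<noteq> 0" and id: "polynomial_identity f"
    using assms by (auto simp: PI_algebra_def)
  let ?K = "Poly_Mapping.keys f"
  have K: "finite ?K" "?K \<noteq> {}" using f by simp_all
  define d where "d = Max (length ` ?K)"
  have "d \<in> length ` ?K" unfolding d_def using K by (intro Max_in) auto
  then obtain w0 where w0: "w0 \<in> ?K" "length w0 = d" by auto
  have le_d: "length w \<le> d" if "w \<in> ?K" for w
    unfolding d_def using K that by auto
  define c where "c \<phi> = Poly_Mapping.lookup f (map ((!) w0) \<phi>)" for \<phi>
  define \<Phi> where "\<Phi> k = {\<phi>. set \<phi> \<subseteq> {..<d} \<and> map ((!) w0) \<phi> \<in> ?K \<and> {..<k} \<subseteq> set \<phi>}" for k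
  have "\<Phi> k \<subseteq> {\<phi>. set \<phi> \<subseteq> {..<d} \<and> length \<phi> \<le> d}" for k
    using le_d by (force simp: \<Phi>_def)
  hence fin: "finite (\<Phi> k)" for k
    by (rule finite_subset) (simp add: finite_lists_length_le)
  have zero: "(\<Sum>\<phi>\<in>\<Phi> k. c \<phi> *s eval_word y \<phi>) = 0" if "k \<le> d" for k y
    using that
  proof (induction k arbitrary: y)
    case 0
    let ?r = "\<lambda>i. \<Sum>j | j \<in> {..<d} \<and> w0 ! j = i. y j"
    let ?L = "\<lambda>w. {\<phi>. set \<phi> \<subseteq> {..<d} \<and> map ((!) w0) \<phi> = w}"
    have finL: "finite (?L w)" for w
    proof (rule finite_subset)
      show "?L w \<subseteq> {\<phi>. set \<phi> \<subseteq> {..<d} \<and> length \<phi> = length w}" by auto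
    qed (simp add: finite_lists_length_eq)
    have "0 = eval_free ?r f" using id by (simp add: polynomial_identity_def)
    also have "\<dots> = (\<Sum>w\<in>?K. \<Sum>\<phi>\<in>?L w. c \<phi> *s eval_word y \<phi>)"
      unfolding eval_free_def
    proof (intro sum.cong refl)
      fix w
      have "eval_word ?r w = (\<Sum>\<phi>\<in>?L w. eval_word y \<phi>)"
        by (rule eval_word_sum) simp
      thus "Poly_Mapping.lookup f w *s eval_word ?r w = (\<Sum>\<phi>\<in>?L w. c \<phi> *s eval_word y \<phi>)"
        by (auto simp: scale_sum_right c_def intro!: sum.cong)
    qed
    also have "\<dots> = (\<Sum>\<phi>\<in>(\<Union>w\<in>?K. ?L w). c \<phi> *s eval_word y \<phi>)"
      using K finL by (intro sum.UNION_disjoint[symmetric]) auto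
    also have "(\<Union>w\<in>?K. ?L w) = \<Phi> 0" by (auto simp: \<Phi>_def)
    finally show ?case by simp
  next
    case (Suc k)
    have *: "eval_word (y(k := 0)) \<phi> = (if k \<in> set \<phi> then 0 else eval_word y \<phi>)" for \<phi>
    proof (cases "k \<in> set \<phi>")
      case True
      have "eval_word (y(k := 0)) \<phi> = list_mult (map (y(k := 0)) \<phi>)"
        using True by (intro eval_word_eq_list_mult) auto
      also have "\<dots> = 0" using True by (intro list_mult_eq_0) force
      finally show ?thesis using True by simp
    next
      case False
      hence "map (y(k := 0)) \<phi> = map y \<phi>" by auto
      thus ?thesis using False by (cases "\<phi> = []") (simp_all add: eval_word_eq_list_mult)
    qed
    have eq: "\<Phi> (Suc k) = {\<phi> \<in> \<Phi> k. k \<in> set \<phi>}"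
      by (auto simp: \<Phi>_def lessThan_Suc)
    have "0 = (\<Sum>\<phi>\<in>\<Phi> k. c \<phi> *s eval_word y \<phi>) - (\<Sum>\<phi>\<in>\<Phi> k. c \<phi> *s eval_word (y(k := 0)) \<phi>)"
      using Suc by simp
    also have "\<dots> = (\<Sum>\<phi>\<in>\<Phi> k. if k \<in> set \<phi> then c \<phi> *s eval_word y \<phi> else 0)"
      unfolding sum_subtractf[symmetric] by (intro sum.cong refl) (simp add: *)
    also have "\<dots> = (\<Sum>\<phi>\<in>\<Phi> (Suc k). c \<phi> *s eval_word y \<phi>)"
      unfolding eq using fin by (simp add: sum.inter_filter)
    finally show ?case by simp
  qed
  have map_w0: "map ((!) w0) [0..<d] = w0" using w0(2) map_nth[of w0] by simp
  have perm: "set \<phi> = {..<d} \<and> length \<phi> = d" if "\<phi> \<in> \<Phi> d" for \<phi>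
  proof -
    have "set \<phi> = {..<d}" using that by (auto simp: \<Phi>_def)
    moreover from this have "d \<le> length \<phi>" using card_length[of \<phi>] by simp
    moreover have "length \<phi> \<le> d" using that le_d by (force simp: \<Phi>_def)
    ultimately show ?thesis by simp
  qed
  show ?thesis
  proof (cases "d = 0")
    case False
    have "multilinear_identity d (\<Phi> d) c"
      unfolding multilinear_identity_def
    proof (intro conjI ballI allI)
      show "[0..<d] \<in> \<Phi> d" using w0(1) map_w0 by (simp add: \<Phi>_def atLeast0LessThan)
      show "c [0..<d] \<noteq> 0" using w0(1) map_w0 by (simp add: c_def in_keys_iff)
    qed (use False fin perm zero in simp_all)
    thus ?thesis by blast
  next
    \<comment> \<open>The identity is a nonzero constant, so the algebra is zero and \<open>y\<^sub>0 = 0\<close> is an identity.\<close>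
    case True
    have c0: "Poly_Mapping.lookup f [] \<noteq> 0" using w0 True by (simp add: in_keys_iff)
    have "unitary" using c0 id by (auto simp: polynomial_identity_def)
    then obtain e where e: "is_unit_elem e" by (auto simp: unitary_def)
    have "?K = {[]}" using w0 True le_d by auto
    hence "Poly_Mapping.lookup f [] *s unit_elem = 0"
      using id by (simp add: polynomial_identity_def eval_free_def)
    hence "e = 0" using c0 unit_elem_eq[OF e] by simp
    hence "y 0 = 0" for y :: "nat \<Rightarrow> 'a"
      using e by (metis is_unit_elem_def mult_zero_left)
    hence "multilinear_identity 1 {[0]} (\<lambda>_. 1)"
      unfolding multilinear_identity_def by (simp add: lessThan_Suc)
    thus ?thesis by blast
  qed
qed

end

section \<open>Words without long descending chains\<close>

definition no_descending_chain :: "nat \<Rightarrow> nat list \<Rightarrow> bool" where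
  "no_descending_chain d w \<longleftrightarrow> (\<forall>xs. subseq xs w \<and> sorted_wrt (>) xs \<longrightarrow> length xs < d)"

lemma descending_chain_of_length:
  assumes "\<not> no_descending_chain d w"
  obtains xs where "subseq xs w" "sorted_wrt (>) xs" "length xs = d"
proof -
  obtain xs where "subseq xs w" "sorted_wrt (>) xs" "d \<le> length xs"
    using assms by (auto simp: no_descending_chain_def not_less)
  thus thesis
    by (intro that[of "take d xs"])
       (auto intro: subseq_order.order_trans[OF sublist_imp_subseq] simp: sorted_wrt_take)
qed

text \<open>
  Cutting \<open>w\<close> before each letter of a subsequence.
\<close>

lemma subseq_split_blocks:
  assumes "subseq xs w"
  shows "\<exists>p vs. w = p @ concat vs \<and> map hd vs = xs \<and> [] \<notin> set vs"
  using assms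
proof (induction xs arbitrary: w)
  case Nil
  show ?case by (rule exI[of _ w], rule exI[of _ "[]"]) simp
next
  case (Cons x xs)
  then obtain p s where w: "w = p @ x # s" and "subseq xs s"
    by (auto dest!: list_emb_ConsD)
  with Cons.IH obtain q vs where "s = q @ concat vs" "map hd vs = xs" "[] \<notin> set vs" by blast
  with w show ?case by (intro exI[of _ p] exI[of _ "(x # q) # vs"]) auto
qed

text \<open>
  At the first position \<open>i\<close> that the permutation moves, a later block comes forward, and its first
  letter is smaller than that of the block \<open>i\<close>.
\<close>

lemma permuted_blocks_lex_less:
  fixes vs :: "nat list list"
  assumes desc: "sorted_wrt (>) (map hd vs)" and ne: "[] \<notin> set vs"
    and perm: "set \<phi> = {..<length vs}" "length \<phi> = length vs"
    and neq: "\<phi> \<noteq> [0..<length vs]"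
  shows "(p @ concat (map ((!) vs) \<phi>), p @ concat vs) \<in> lex less_than"
proof -
  let ?d = "length vs"
  have dist: "distinct \<phi>" using perm by (simp add: card_distinct)
  have "mset \<phi> = mset [0..<?d]"
    using set_eq_iff_mset_eq_distinct[of \<phi> "[0..<?d]"] dist perm(1)
    by (simp add: atLeast0LessThan)
  hence "mset (map ((!) vs) \<phi>) = mset (map ((!) vs) [0..<?d])" by (metis mset_map)
  hence "mset (map ((!) vs) \<phi>) = mset vs" by (simp add: map_nth)
  moreover have "mset (concat us) = sum_mset (image_mset mset (mset us))" for us :: "nat list list"
    by (simp add: mset_concat flip: sum_mset_sum_list)
  ultimately have "mset (concat (map ((!) vs) \<phi>)) = mset (concat vs)" by simp
  hence len: "length (concat (map ((!) vs) \<phi>)) = length (concat vs)" by (rule mset_eq_length)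
  define i where "i = (LEAST i. i < ?d \<and> \<phi> ! i \<noteq> i)"
  have "\<exists>i. i < ?d \<and> \<phi> ! i \<noteq> i"
  proof (rule ccontr)
    assume "\<not> ?thesis"
    hence "\<phi> = [0..<?d]" using perm(2) by (intro nth_equalityI) simp_all
    thus False using neq by contradiction
  qed
  hence i: "i < ?d" "\<phi> ! i \<noteq> i" unfolding i_def by (metis (mono_tags, lifting) LeastI)+
  have before: "\<phi> ! j = j" if "j < i" for j
    using not_less_Least[of j "\<lambda>i. i < ?d \<and> \<phi> ! i \<noteq> i"] that i(1) unfolding i_def by auto
  have less: "\<phi> ! i < ?d" using perm i(1) by (metis lessThan_iff nth_mem)
  have "i < \<phi> ! i"
  proof (rule ccontr)
    assume "\<not> i < \<phi> ! i"
    hence "\<phi> ! i < i" using i(2) by simp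
    hence "\<phi> ! (\<phi> ! i) = \<phi> ! i" by (rule before)
    thus False using dist i \<open>\<phi> ! i < i\<close> perm(2) less by (metis nth_eq_iff_index_eq)
  qed
  hence hd_less: "hd (vs ! (\<phi> ! i)) < hd (vs ! i)"
    using desc less by (auto simp: sorted_wrt_iff_nth_less)
  let ?us = "map ((!) vs) \<phi>"
  have take_eq: "take i ?us = take i vs"
    using i(1) perm(2) before by (intro nth_equalityI) auto
  have "vs = take i vs @ vs ! i # drop (Suc i) vs"
    using i(1) by (rule id_take_nth_drop)
  moreover have "?us = take i vs @ vs ! (\<phi> ! i) # drop (Suc i) ?us"
    using id_take_nth_drop[of i ?us] i(1) perm(2) take_eq by simp
  moreover obtain a s where "vs ! i = a # s" using ne i(1) by (metis neq_Nil_conv nth_mem)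
  moreover obtain b t where "vs ! (\<phi> ! i) = b # t" using ne less by (metis neq_Nil_conv nth_mem)
  ultimately have "\<exists>s t. concat vs = concat (take i vs) @ hd (vs ! i) # s \<and>
      concat ?us = concat (take i vs) @ hd (vs ! (\<phi> ! i)) # t"
    by (metis append_Cons concat.simps(2) concat_append list.sel(1))
  then obtain s t where "concat vs = concat (take i vs) @ hd (vs ! i) # s"
      "concat ?us = concat (take i vs) @ hd (vs ! (\<phi> ! i)) # t" by blast
  moreover from this len have "(hd (vs ! (\<phi> ! i)) # t, hd (vs ! i) # s) \<in> lex less_than"
    using hd_less by simp
  ultimately show ?thesis by (simp add: lex_append_leftI)
qed

context associative_algebra
begin

text \<open>
  Rewriting by the multilinear identity replaces a word with a descending chain of length \<open>d\<close> by
  lexicographically smaller words of the same length, so the rewriting terminates.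
\<close>

lemma list_mult_in_span_no_descending_chain:
  assumes ml: "multilinear_identity d \<Phi> c"
    and w: "set w \<subseteq> {..<M}" "length w = N"
  shows "list_mult (map h w) \<in>
    span ((\<lambda>w. list_mult (map h w)) ` {w. set w \<subseteq> {..<M} \<and> length w = N \<and> no_descending_chain d w})"
    (is "_ \<in> span (?e ` ?G)")
proof -
  have "wf (lex less_than)" by (simp add: wf_lex)
  thus ?thesis using w
  proof (induction w rule: wf_induct_rule)
    case (less w)
    show ?case
    proof (cases "no_descending_chain d w")
      case True
      thus ?thesis using less.prems by (intro span_base imageI) simp
    next
      case False
      then obtain xs where xs: "subseq xs w" "sorted_wrt (>) xs" "length xs = d"
        by (rule descending_chain_of_length)
      obtain p vs where vs: "w = p @ concat vs" "map hd vs = xs" "[] \<notin> set vs"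
        using subseq_split_blocks[OF xs(1)] by blast
      have len_vs: "length vs = d" using vs xs by auto
      let ?p = "\<lambda>\<phi>. p @ concat (map ((!) vs) \<phi>)"
      let ?y = "\<lambda>i. ?e (vs ! i)"
      from ml have d: "0 < d" and fin: "finite \<Phi>" and id: "[0..<d] \<in> \<Phi>" "c [0..<d] \<noteq> 0"
        and perm: "\<And>\<phi>. \<phi> \<in> \<Phi> \<Longrightarrow> set \<phi> = {..<d}" "\<And>\<phi>. \<phi> \<in> \<Phi> \<Longrightarrow> length \<phi> = d"
        and zero: "(\<Sum>\<phi>\<in>\<Phi>. c \<phi> *s eval_word ?y \<phi>) = 0"
        by (auto simp: multilinear_identity_def)
      have eval: "eval_word ?y \<phi> = ?e (concat (map ((!) vs) \<phi>))"
        and ne: "concat (map ((!) vs) \<phi>) \<noteq> []" if "\<phi> \<in> \<Phi>" for \<phi>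
      proof -
        have ne': "\<phi> \<noteq> []" "[] \<notin> set (map ((!) vs) \<phi>)"
          using perm[OF that] d vs(3) len_vs by (auto simp: in_set_conv_nth)
        thus "concat (map ((!) vs) \<phi>) \<noteq> []" by (cases \<phi>) auto
        have "eval_word ?y \<phi> = list_mult (map ?y \<phi>)"
          using ne'(1) by (rule eval_word_eq_list_mult)
        also have "map ?y \<phi> = map list_mult (map (map h) (map ((!) vs) \<phi>))" by simp
        also have "list_mult \<dots> = list_mult (concat (map (map h) (map ((!) vs) \<phi>)))"
          using ne' by (intro list_mult_concat[symmetric]) (auto simp: image_iff)
        finally show "eval_word ?y \<phi> = ?e (concat (map ((!) vs) \<phi>))"
          by (simp only: map_concat)
      qed
      have "(\<Sum>\<phi>\<in>\<Phi>. c \<phi> *s ?e (?p \<phi>)) = 0"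
      proof (cases "p = []")
        case True
        thus ?thesis using zero eval by simp
      next
        case False
        have "(\<Sum>\<phi>\<in>\<Phi>. c \<phi> *s ?e (?p \<phi>)) = (\<Sum>\<phi>\<in>\<Phi>. ?e p * (c \<phi> *s eval_word ?y \<phi>))"
          using False ne eval by (intro sum.cong refl) (simp add: list_mult_append scale_mult_right)
        also have "\<dots> = 0" using zero by (simp add: sum_distrib_left[symmetric])
        finally show ?thesis .
      qed
      hence "c [0..<d] *s ?e (?p [0..<d]) + (\<Sum>\<phi>\<in>\<Phi> - {[0..<d]}. c \<phi> *s ?e (?p \<phi>)) = 0"
        using sum.remove[OF fin id(1), of "\<lambda>\<phi>. c \<phi> *s ?e (?p \<phi>)"] by simp
      moreover have "?p [0..<d] = w" using vs(1) len_vs map_nth[of vs] by simp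
      ultimately have "c [0..<d] *s ?e w = - (\<Sum>\<phi>\<in>\<Phi> - {[0..<d]}. c \<phi> *s ?e (?p \<phi>))"
        by (simp add: eq_neg_iff_add_eq_0)
      moreover have "(\<Sum>\<phi>\<in>\<Phi> - {[0..<d]}. c \<phi> *s ?e (?p \<phi>)) \<in> span (?e ` ?G)"
      proof (intro span_sum span_scale)
        fix \<phi> assume \<phi>: "\<phi> \<in> \<Phi> - {[0..<d]}"
        have lex: "(?p \<phi>, w) \<in> lex less_than"
          unfolding vs(1) using \<phi> perm vs xs len_vs by (intro permuted_blocks_lex_less) auto
        hence "length (?p \<phi>) = length w" by (simp add: lex_conv)
        moreover have "(!) vs ` set \<phi> \<subseteq> set vs"
          using \<phi> perm len_vs nth_mem[of _ vs] by blast
        hence "set (?p \<phi>) \<subseteq> set w" unfolding vs(1) by auto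
        ultimately show "?e (?p \<phi>) \<in> span (?e ` ?G)"
          using less.prems by (intro less.IH[OF lex]) auto
      qed
      ultimately have "c [0..<d] *s ?e w \<in> span (?e ` ?G)" by (simp add: span_neg)
      hence "inverse (c [0..<d]) *s (c [0..<d] *s ?e w) \<in> span (?e ` ?G)" by (rule span_scale)
      thus ?thesis using id(2) by simp
    qed
  qed
qed

end

text \<open>
  The partition into weakly increasing subsequences. Colour each letter by the greedy rule: reading from
  the right, a letter gets the least colour none of whose letters is smaller. A letter of colour
  \<open>k + 1\<close> then precedes a smaller letter of colour \<open>k\<close>, so colours count the steps of a descending chain.
\<close>

lemma descending_chain_coloring:
  "\<exists>P. map snd P = w \<and> (\<forall>k. sorted (map snd (filter (\<lambda>x. fst x = k) P))) \<and>
     (\<forall>(k, a)\<in>set P. \<exists>xs. subseq (a # xs) w \<and> sorted_wrt (>) (a # xs) \<and> length xs = k)"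
proof (induction w)
  case (Cons a w)
  then obtain P where P: "map snd P = w"
      "\<And>k. sorted (map snd (filter (\<lambda>x. fst x = k) P))"
      "\<And>k b. (k, b) \<in> set P \<Longrightarrow>
         \<exists>xs. subseq (b # xs) w \<and> sorted_wrt (>) (b # xs) \<and> length xs = k"
    by fast
  \<comment> \<open>\<open>ok k\<close>: colouring \<open>a\<close> by \<open>k\<close> keeps the letters of colour \<open>k\<close> weakly increasing.\<close>
  define ok where "ok k \<longleftrightarrow> (\<forall>b. (k, b) \<in> set P \<longrightarrow> a \<le> b)" for k
  have "\<exists>k. ok k"
  proof -
    have "finite (fst ` set P)" by simp
    then obtain k where "k \<notin> fst ` set P" using ex_new_if_finite by blast
    hence "ok k" by (force simp: ok_def)
    thus ?thesis ..
  qed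
  define k where "k = (LEAST k. ok k)"
  have "ok k" unfolding k_def using \<open>\<exists>k. ok k\<close> by (rule LeastI_ex)
  have chain: "\<exists>xs. subseq (a # xs) (a # w) \<and> sorted_wrt (>) (a # xs) \<and> length xs = k"
  proof (cases k)
    case 0
    thus ?thesis by (intro exI[of _ "[]"]) simp
  next
    case (Suc j)
    hence "\<not> ok j" using not_less_Least[of j ok] by (simp add: k_def)
    then obtain b where "(j, b) \<in> set P" "b < a" by (auto simp: ok_def not_le)
    with P(3) obtain xs where "subseq (b # xs) w" "sorted_wrt (>) (b # xs)" "length xs = j"
      by blast
    with \<open>b < a\<close> Suc show ?thesis
      by (intro exI[of _ "b # xs"]) auto
  qed
  show ?case
  proof (intro exI[of _ "(k, a) # P"] conjI allI ballI)
    show "map snd ((k, a) # P) = a # w" using P by simp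
    show "sorted (map snd (filter (\<lambda>x. fst x = l) ((k, a) # P)))" for l
      using P(2)[of l] \<open>ok k\<close> by (auto simp: ok_def)
    fix x assume x: "x \<in> set ((k, a) # P)"
    show "case x of (k, b) \<Rightarrow>
        \<exists>xs. subseq (b # xs) (a # w) \<and> sorted_wrt (>) (b # xs) \<and> length xs = k"
    proof (cases "x = (k, a)")
      case True
      thus ?thesis using chain by simp
    next
      case False
      then obtain l b where lb: "x = (l, b)" "(l, b) \<in> set P" using x by (cases x) auto
      with P(3) obtain xs where "subseq (b # xs) w" "sorted_wrt (>) (b # xs)" "length xs = l"
        by blast
      moreover from this have "subseq (b # xs) (a # w)" by (intro list_emb_Cons)
      ultimately show ?thesis unfolding lb(1) prod.case by blast
    qed
  qed
qed simp

text \<open>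
  The letters of one colour form a sorted list, which their multiset determines; the sequence of colours
  then says how to merge these lists.
\<close>

lemma colored_list_eqI:
  assumes "map fst P = map fst Q" "mset P = mset Q"
    and "\<And>k. sorted (map snd (filter (\<lambda>x. fst x = k) P))"
    and "\<And>k. sorted (map snd (filter (\<lambda>x. fst x = k) Q))"
  shows "P = (Q :: (nat \<times> nat) list)"
  using assms
proof (induction P arbitrary: Q)
  case (Cons x P)
  then obtain y Q' where Q: "Q = y # Q'" by (cases Q) auto
  have fst: "fst y = fst x" using Cons.prems Q by simp
  let ?f = "\<lambda>L. map snd (filter (\<lambda>z. fst z = fst x) L)"
  have "mset (?f (x # P)) = mset (?f Q)" using Cons.prems(2) by (metis mset_filter mset_map)
  hence "?f (x # P) = ?f Q"
    using Cons.prems(3,4)[of "fst x"] by (metis properties_for_sort sorted_sort_id)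
  hence "x = y" using fst by (simp add: Q prod_eq_iff)
  moreover have "P = Q'"
  proof (rule Cons.IH)
    show "sorted (map snd (filter (\<lambda>x. fst x = k) P))" for k
      using Cons.prems(3)[of k] by (auto split: if_splits)
    show "sorted (map snd (filter (\<lambda>x. fst x = k) Q'))" for k
      using Cons.prems(4)[of k] Q by (auto split: if_splits)
  qed (use Cons.prems Q \<open>x = y\<close> in auto)
  ultimately show ?case using Q by simp
qed simp

text \<open>
  By the previous lemma a coloured word is determined by its sequence of colours (at most \<open>d\<^sup>N\<close>
  possibilities) and by how often each letter occurs in each colour (a number up to \<open>N\<close> for each of
  the \<open>d * M\<close> pairs).
\<close>

lemma card_no_descending_chain_le:
  "card {w. set w \<subseteq> {..<M} \<and> length w = N \<and> no_descending_chain d w}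
     \<le> d ^ N * (N + 1) ^ (d * M)" (is "card ?G \<le> _")
proof -
  define good where "good w P \<longleftrightarrow> map snd P = w \<and> fst ` set P \<subseteq> {..<d} \<and>
      (\<forall>k. sorted (map snd (filter (\<lambda>x. fst x = k) P)))" for w and P :: "(nat \<times> nat) list"
  have "\<exists>P. good w P" if "no_descending_chain d w" for w
  proof -
    obtain P where P: "map snd P = w" "\<forall>k. sorted (map snd (filter (\<lambda>x. fst x = k) P))"
      "\<forall>(k, a)\<in>set P. \<exists>xs. subseq (a # xs) w \<and> sorted_wrt (>) (a # xs) \<and> length xs = k"
      using descending_chain_coloring by blast
    have "k < d" if "(k, a) \<in> set P" for k a
    proof -
      obtain xs where "subseq (a # xs) w" "sorted_wrt (>) (a # xs)" "length xs = k"
        using P(3) \<open>(k, a) \<in> set P\<close> by blast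
      hence "length (a # xs) < d"
        using \<open>no_descending_chain d w\<close> unfolding no_descending_chain_def by blast
      thus ?thesis using \<open>length xs = k\<close> by simp
    qed
    hence "fst ` set P \<subseteq> {..<d}" by force
    hence "good w P" unfolding good_def using P(1,2) by blast
    thus ?thesis ..
  qed
  then obtain P where P: "\<And>w. no_descending_chain d w \<Longrightarrow> good w (P w)" by metis
  define code where "code w = (map fst (P w), restrict (count (mset (P w))) ({..<d} \<times> {..<M}))" for w
  let ?C = "{cs. set cs \<subseteq> {..<d} \<and> length cs = N} \<times> (({..<d} \<times> {..<M}) \<rightarrow>\<^sub>E {..N})"
  have "inj_on code ?G"
  proof (rule inj_onI)
    fix v w assume v: "v \<in> ?G" and w: "w \<in> ?G" and eq: "code v = code w"
    have good: "good v (P v)" "good w (P w)" using P v w by auto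
    have outside: "count (mset (P u)) z = 0" if "u \<in> ?G" "z \<notin> {..<d} \<times> {..<M}" for u z
    proof -
      have "good u (P u)" using P that by auto
      hence "fst ` set (P u) \<subseteq> {..<d}" "snd ` set (P u) \<subseteq> {..<M}"
        using that(1) unfolding good_def by (auto simp flip: set_map)
      hence "set (P u) \<subseteq> {..<d} \<times> {..<M}" by (simp add: image_subset_iff mem_Times_iff subset_iff)
      hence "z \<notin># mset (P u)" using that(2) by auto
      thus ?thesis by (rule not_in_iff[THEN iffD1])
    qed
    have "mset (P v) = mset (P w)"
    proof (rule multiset_eqI)
      fix z
      show "count (mset (P v)) z = count (mset (P w)) z"
      proof (cases "z \<in> {..<d} \<times> {..<M}")
        case True
        moreover have "snd (code v) z = snd (code w) z" using eq by simp
        ultimately show ?thesis by (simp add: code_def)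
      next
        case False
        show ?thesis by (simp only: outside[OF v False] outside[OF w False])
      qed
    qed
    moreover have "map fst (P v) = map fst (P w)" using eq by (simp add: code_def)
    ultimately have "P v = P w"
      using good unfolding good_def by (intro colored_list_eqI) blast+
    thus "v = w" using good by (simp add: good_def)
  qed
  moreover have "code ` ?G \<subseteq> ?C"
  proof
    fix x assume "x \<in> code ` ?G"
    then obtain w where w: "w \<in> ?G" "x = code w" by blast
    hence "good w (P w)" using P by auto
    hence Pw: "map snd (P w) = w" and "fst ` set (P w) \<subseteq> {..<d}" by (auto simp: good_def)
    moreover have "length (P w) = N" using w(1) arg_cong[OF Pw, of length] by simp
    ultimately have len: "length (P w) = N" "fst ` set (P w) \<subseteq> {..<d}" by simp_all
    have "count (mset (P w)) z \<le> N" for z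
      using count_le_size[of "mset (P w)" z] len by simp
    thus "x \<in> ?C" using len w(2) by (auto simp: code_def)
  qed
  moreover have "finite ?C"
    by (intro finite_cartesian_product finite_lists_length_eq finite_PiE) auto
  ultimately have "card ?G \<le> card ?C" by (rule card_inj_on_le)
  also have "card ?C = d ^ N * (N + 1) ^ (d * M)"
    by (simp add: card_cartesian_product card_lists_length_eq card_PiE)
  finally show ?thesis .
qed

section \<open>Growth of graded algebras with a polynomial identity\<close>

context associative_algebra
begin

lemma span_mult_closed:
  assumes U: "\<And>u v. u \<in> U \<Longrightarrow> v \<in> U \<Longrightarrow> u * v \<in> span U"
    and x: "x \<in> span U" and y: "y \<in> span U"
  shows "x * y \<in> span U"
  using x
proof (rule span_induct)
  show "subspace {x. x * y \<in> span U}"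
    by (auto simp: subspace_def distrib_right scale_mult_left span_zero span_add span_scale)
next
  fix u assume u: "u \<in> U"
  show "u * y \<in> span U"
    using y
  proof (rule span_induct)
    show "subspace {y. u * y \<in> span U}"
      by (auto simp: subspace_def distrib_left scale_mult_right span_zero span_add span_scale)
  qed (use U u in auto)
qed

text \<open>
  The set on the left is closed under multiplication, whether or not there is a unit.
\<close>

lemma generated_by_imp_span:
  assumes "generated_by S"
  shows "span (list_mult ` {xs. set xs \<subseteq> S \<and> xs \<noteq> []} \<union> {e. is_unit_elem e}) = UNIV"
    (is "span ?U = UNIV")
proof -
  have "subalgebra (span ?U)"
    unfolding subalgebra_def
  proof (intro conjI ballI impI)
    fix x y assume "x \<in> span ?U" "y \<in> span ?U"
    moreover have "u * v \<in> span ?U" if "u \<in> ?U" "v \<in> ?U" for u v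
    proof -
      have "u * v \<in> ?U"
      proof (cases "is_unit_elem u \<or> is_unit_elem v")
        case True
        hence "u * v = v \<or> u * v = u" by (auto simp: is_unit_elem_def)
        thus ?thesis using that by metis
      next
        case False
        with that obtain xs ys where *: "u = list_mult xs" "v = list_mult ys"
          "set xs \<subseteq> S" "xs \<noteq> []" "set ys \<subseteq> S" "ys \<noteq> []" by blast
        hence "u * v = list_mult (xs @ ys)" by (simp add: list_mult_append)
        moreover have "xs @ ys \<in> {xs. set xs \<subseteq> S \<and> xs \<noteq> []}" using * by simp
        ultimately show ?thesis by blast
      qed
      thus ?thesis by (rule span_base)
    qed
    ultimately show "x * y \<in> span ?U" by (rule span_mult_closed[rotated])
  next
    assume unitary
    then obtain e where "is_unit_elem e" by (auto simp: unitary_def)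
    thus "unit_elem \<in> span ?U" by (intro span_base) (simp add: unit_elem_eq)
  qed simp
  moreover have "S \<subseteq> span ?U"
  proof
    fix s assume "s \<in> S"
    hence "s \<in> list_mult ` {xs. set xs \<subseteq> S \<and> xs \<noteq> []}" by (intro image_eqI[of _ _ "[s]"]) auto
    thus "s \<in> span ?U" by (intro span_base) simp
  qed
  ultimately have "subalgebra hull S \<subseteq> span ?U" by (intro hull_minimal)
  thus ?thesis using assms by (auto simp: generated_by_def)
qed

end

context graded_algebra
begin

lemma homogeneous_sum_unique:
  assumes "finite A" "\<And>k. k \<in> A \<Longrightarrow> a k \<in> R k" "finite B" "\<And>k. k \<in> B \<Longrightarrow> b k \<in> R k"
    and "sum a A = sum b B"
  shows "(if n \<in> A then a n else 0) = (if n \<in> B then b n else 0)"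
proof -
  define P where
    "P x c \<longleftrightarrow> finite {k. c k \<noteq> 0} \<and> (\<forall>k. c k \<in> R k) \<and> x = (\<Sum>k | c k \<noteq> 0. c k)" for x c
  have P: "P (sum c C) (\<lambda>k. if k \<in> C then c k else 0)"
    if C: "finite C" "\<And>k. k \<in> C \<Longrightarrow> c k \<in> R k" for c C
    unfolding P_def
  proof (intro conjI allI)
    let ?c = "\<lambda>k. if k \<in> C then c k else 0"
    show "finite {k. ?c k \<noteq> 0}" using C(1) by (rule rev_finite_subset) auto
    show "?c k \<in> R k" for k using C(2) subspace_0[OF subspace_component] by simp
    have "(\<Sum>k | ?c k \<noteq> 0. ?c k) = (\<Sum>k\<in>C. ?c k)"
      using C(1) by (intro sum.mono_neutral_left) auto
    thus "sum c C = (\<Sum>k | ?c k \<noteq> 0. ?c k)" by simp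
  qed
  have 1: "P (sum a A) (\<lambda>k. if k \<in> A then a k else 0)" using assms(1,2) by (rule P)
  have 2: "P (sum a A) (\<lambda>k. if k \<in> B then b k else 0)"
    unfolding assms(5) using assms(3,4) by (rule P)
  have "(\<lambda>k. if k \<in> A then a k else 0) = (\<lambda>k. if k \<in> B then b k else 0)"
    using direct_sum[of "sum a A", folded P_def] 1 2 by blast
  thus ?thesis by (rule fun_cong)
qed

lemma component_subset_span:
  assumes T: "\<And>k. T k \<subseteq> R k" and span: "span (\<Union>k. T k) = UNIV"
  shows "R n \<subseteq> span (T n)"
proof
  fix x assume x: "x \<in> R n"
  have "x \<in> span (\<Union>k. T k)" using span by simp
  then obtain t r where t: "finite t" "t \<subseteq> (\<Union>k. T k)" and sum: "x = (\<Sum>a\<in>t. r a *s a)"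
    unfolding span_explicit by auto
  from t(2) obtain deg where deg: "\<And>a. a \<in> t \<Longrightarrow> a \<in> T (deg a)" by (metis UN_E subsetD)
  define c where "c k = (\<Sum>a | a \<in> t \<and> deg a = k. r a *s a)" for k
  have c_span: "c k \<in> span (T k)" for k
    unfolding c_def using deg by (intro span_sum span_scale span_base) auto
  have "span (T k) \<subseteq> R k" for k using T by (intro span_minimal subspace_component)
  hence c_R: "c k \<in> R k" for k using c_span by auto
  have "x = sum c (deg ` t)" unfolding c_def sum using t(1) by (rule sum.image_gen)
  hence "(if n \<in> deg ` t then c n else 0) = (if n \<in> {n} then x else 0)"
    using t(1) c_R x by (intro homogeneous_sum_unique) auto
  thus "x \<in> span (T n)" using c_span[of n] span_zero by (metis singletonI)
qed

text \<open>
  If the unit has no component of degree 0, multiplication by it raises the degree of homogeneous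
  elements strictly.
\<close>

lemma unitary_component_zero_trivial:
  assumes unitary "R 0 = {0}" "x \<in> R n"
  shows "x = 0"
proof -
  obtain e where e: "is_unit_elem e" using assms(1) by (auto simp: unitary_def)
  obtain c where c: "finite {k. c k \<noteq> 0}" "\<And>k. c k \<in> R k" "e = (\<Sum>k | c k \<noteq> 0. c k)"
    using direct_sum[of e] by blast
  let ?A = "{k. c k \<noteq> 0}"
  have "0 \<notin> ?A" using c(2)[of 0] assms(2) by simp
  have "x = e * x" using e by (simp add: is_unit_elem_def)
  also have "\<dots> = (\<Sum>k\<in>?A. c k * x)" unfolding c(3) by (rule sum_distrib_right)
  also have "\<dots> = (\<Sum>k\<in>(\<lambda>k. k + n) ` ?A. c (k - n) * x)"
    by (subst sum.reindex) (auto simp: inj_on_def)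
  finally have *: "x = (\<Sum>k\<in>(\<lambda>k. k + n) ` ?A. c (k - n) * x)" .
  show ?thesis
  proof -
    let ?B = "(\<lambda>k. k + n) ` ?A"
    have "c (k - n) * x \<in> R k" if "k \<in> ?B" for k
      using that mult_component[OF c(2) assms(3)] by auto
    moreover have "n \<notin> ?B" using \<open>0 \<notin> ?A\<close> by auto
    moreover have "(if n \<in> {n} then x else 0) = (if n \<in> ?B then c (n - n) * x else 0)"
    proof (rule homogeneous_sum_unique[where a = "\<lambda>_. x" and b = "\<lambda>k. c (k - n) * x"])
      show "(\<Sum>k\<in>{n}. x) = (\<Sum>k\<in>?B. c (k - n) * x)" unfolding *[symmetric] by simp
    qed (use calculation(1) c(1) assms(3) in auto)
    ultimately show ?thesis by simp
  qed
qed

lemma list_mult_component: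
  assumes "xs \<noteq> []" "set xs \<subseteq> R 1"
  shows "list_mult xs \<in> R (length xs)"
  using assms
proof (induction xs)
  case (Cons x xs)
  thus ?case
    using mult_component[of x 1 "list_mult xs" "length xs"]
    by (cases "xs = []") (simp_all add: list_mult_Cons)
qed simp

lemma component_subset_span_list_mult:
  assumes S: "S \<subseteq> R 1" "generated_by S" and n: "0 < n"
  shows "R n \<subseteq> span (list_mult ` {xs. set xs \<subseteq> S \<and> length xs = n})"
proof (cases "unitary \<and> R 0 = {0}")
  \<comment> \<open>The argument below needs the unit to be homogeneous of degree 0, which may fail here.\<close>
  case True
  hence "R n \<subseteq> {0}" using unitary_component_zero_trivial by blast
  thus ?thesis using span_zero by blast
next
  case False
  let ?L = "\<lambda>k. list_mult ` {xs. set xs \<subseteq> S \<and> xs \<noteq> [] \<and> length xs = k}"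
  let ?T = "\<lambda>k. ?L k \<union> (if k = 0 then {e. is_unit_elem e} else {})"
  have "R n \<subseteq> span (?T n)"
  proof (rule component_subset_span)
    fix k
    have "?L k \<subseteq> R k" using list_mult_component S(1) by blast
    moreover have "e \<in> R 0" if e: "is_unit_elem e" for e
    proof -
      have unitary using e by (auto simp: unitary_def)
      hence "R 0 = range (\<lambda>c. c *s e)"
        using False component_zero unit_elem_eq[OF e] by simp
      thus ?thesis by (metis rangeI scale_one)
    qed
    ultimately show "?T k \<subseteq> R k" by auto
  next
    have "(\<Union>k. ?T k) = list_mult ` {xs. set xs \<subseteq> S \<and> xs \<noteq> []} \<union> {e. is_unit_elem e}"
      by (auto split: if_splits)
    thus "span (\<Union>k. ?T k) = UNIV" using generated_by_imp_span[OF S(2)] by simp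
  qed
  also have "?T n \<subseteq> list_mult ` {xs. set xs \<subseteq> S \<and> length xs = n}" using n by auto
  hence "span (?T n) \<subseteq> span (list_mult ` {xs. set xs \<subseteq> S \<and> length xs = n})" by (rule span_mono)
  finally show ?thesis .
qed

end

lemma split_into_blocks:
  assumes "0 < N" "l * N \<le> length xs" "length xs < l * (N + 1)"
  shows "\<exists>xss. concat xss = xs \<and> length xss = N \<and> (\<forall>ys\<in>set xss. l \<le> length ys \<and> length ys \<le> 2 * l)"
  using assms
proof (induction N arbitrary: xs rule: nat_induct_non_zero)
  case 1
  thus ?case by (intro exI[of _ "[xs]"]) simp
next
  case (Suc N)
  from Suc.prems have "l + l * N \<le> length xs" "length xs < l + l * (N + 1)" by simp_all
  hence "l * N \<le> length (drop l xs)" "length (drop l xs) < l * (N + 1)"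
    unfolding length_drop by linarith+
  with Suc.IH[of "drop l xs"] obtain xss where "concat xss = drop l xs" "length xss = N"
    "\<forall>ys\<in>set xss. l \<le> length ys \<and> length ys \<le> 2 * l" by blast
  thus ?case using Suc.prems by (intro exI[of _ "take l xs # xss"]) auto
qed

text \<open>
  The exponential rate \<open>d\<^bsup>1/l\<^esup>\<close> can be brought as close to 1 as desired, because \<open>d\<close> depends on the
  identity only; enlarging the alphabet affects only the degree \<open>d * M\<close> of the polynomial factor.
\<close>

theorem (in graded_algebra) PI_growth:
  assumes fg: finitely_generated_in_degree_one and PI: PI_algebra
  shows "\<exists>d>0. \<forall>l>0. \<exists>M. \<forall>n\<ge>l. dim (R n) \<le> d ^ (n div l) * (n div l + 1) ^ (d * M)"
proof -
  obtain d \<Phi> c where ml: "multilinear_identity d \<Phi> c" using multilinear_identity_exists[OF PI] by blast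
  obtain S where S: "finite S" "S \<subseteq> R 1" "generated_by S"
    using fg by (auto simp: finitely_generated_in_degree_one_def)
  have "\<exists>M. \<forall>n\<ge>l. dim (R n) \<le> d ^ (n div l) * (n div l + 1) ^ (d * M)" if l: "0 < l" for l
  proof -
    \<comment> \<open>The letters are the products of at most \<open>2 * l\<close> generators. Blocks of length between \<open>l\<close> and \<open>2 * l\<close>
      make up every product of \<open>n \<ge> l\<close> generators, also when \<open>l\<close> does not divide \<open>n\<close>.\<close>
    define F where "F = list_mult ` {xs. set xs \<subseteq> S \<and> length xs \<le> 2 * l}"
    have "finite F" unfolding F_def using S(1) by (intro finite_imageI finite_lists_length_le)
    then obtain M h where "F = h ` {i :: nat. i < M}"
      using finite_imp_nat_seg_image_inj_on by metis
    hence F: "F = h ` {..<M}" by (simp add: lessThan_def)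
    have "dim (R n) \<le> d ^ (n div l) * (n div l + 1) ^ (d * M)" if n: "l \<le> n" for n
    proof -
      define N where "N = n div l"
      have N: "0 < N" "l * N \<le> n" "n < l * (N + 1)"
        using l n by (auto simp: N_def div_greater_zero_iff dividend_less_times_div)
      let ?e = "\<lambda>w. list_mult (map h w)"
      let ?G = "{w. set w \<subseteq> {..<M} \<and> length w = N \<and> no_descending_chain d w}"
      have "list_mult xs \<in> span (?e ` ?G)" if xs: "set xs \<subseteq> S" "length xs = n" for xs
      proof -
        obtain xss where xss: "concat xss = xs" "length xss = N"
            "\<forall>ys\<in>set xss. l \<le> length ys \<and> length ys \<le> 2 * l"
          using split_into_blocks[of N l xs] N xs by auto
        have ne: "xss \<noteq> []" "[] \<notin> set xss" using xss(2,3) N(1) l by auto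
        have in_F: "list_mult ys \<in> F" if "ys \<in> set xss" for ys
          using that xss(3) xs(1) unfolding F_def xss(1)[symmetric] by (intro imageI) auto
        define w where "w = map (inv_into {..<M} h) (map list_mult xss)"
        have "map h w = map list_mult xss"
          using in_F by (simp add: w_def F f_inv_into_f)
        hence "list_mult xs = ?e w" using list_mult_concat[OF ne] xss(1) by simp
        moreover have "set w \<subseteq> {..<M}"
          using in_F inv_into_into[of _ h "{..<M}"] by (auto simp: w_def F simp del: lessThan_iff)
        moreover have "length w = N" using xss(2) by (simp add: w_def)
        ultimately show ?thesis using list_mult_in_span_no_descending_chain[OF ml] by simp
      qed
      hence "span (list_mult ` {xs. set xs \<subseteq> S \<and> length xs = n}) \<subseteq> span (?e ` ?G)"
        by (intro span_minimal) auto
      with component_subset_span_list_mult[OF S(2,3)] l n have "R n \<subseteq> span (?e ` ?G)"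
        by (meson less_le_trans subset_trans)
      moreover have fin: "finite ?G"
        by (rule finite_subset[OF _ finite_lists_length_eq[of "{..<M}" N]]) auto
      ultimately have "dim (R n) \<le> card (?e ` ?G)" by (intro dim_le_card finite_imageI)
      also have "\<dots> \<le> card ?G" using fin by (rule card_image_le)
      also have "\<dots> \<le> d ^ N * (N + 1) ^ (d * M)" by (rule card_no_descending_chain_le)
      finally show ?thesis by (simp add: N_def)
    qed
    thus ?thesis by blast
  qed
  moreover have "0 < d" using ml by (simp add: multilinear_identity_def)
  ultimately show ?thesis by blast
qed

section \<open>Square-summability of the coefficients of a bounded power series\<close>

text \<open>
  Parseval's identity for polynomials of degree below \<open>J\<close>, with the mean over the \<open>J\<close>-th roots of unity
  in the place of an integral over the unit circle: distinct powers below \<open>J\<close> are orthogonal there.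
\<close>

lemma sum_norm_sq_roots_of_unity:
  fixes b :: "nat \<Rightarrow> complex"
  assumes J: "0 < J"
  defines "\<zeta> \<equiv> \<lambda>k. exp (2 * of_real pi * \<i> * of_nat k / of_nat J)"
  shows "(\<Sum>k<J. (norm (\<Sum>n<J. b n * \<zeta> k ^ n))\<^sup>2) = real J * (\<Sum>n<J. (norm (b n))\<^sup>2)"
proof -
  have swap: "\<zeta> k ^ n = \<zeta> n ^ k" for k n
    unfolding \<zeta>_def exp_of_nat_mult[symmetric] by (simp add: algebra_simps)
  have norm1: "norm (\<zeta> k) = 1" for k
    by (simp add: \<zeta>_def norm_exp_eq_Re)
  have orth: "(\<Sum>k<J. \<zeta> k ^ n * cnj (\<zeta> k ^ m)) = (if n = m then of_nat J else 0)"
    if "n < J" "m < J" for n m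
  proof -
    let ?q = "\<zeta> n * cnj (\<zeta> m)"
    have sum: "(\<Sum>k<J. \<zeta> k ^ n * cnj (\<zeta> k ^ m)) = (\<Sum>k<J. ?q ^ k)"
      by (simp add: swap[of _ n] swap[of _ m] power_mult_distrib)
    have inv: "\<zeta> m * cnj (\<zeta> m) = 1" using norm1[of m] by (simp add: complex_norm_square[symmetric])
    have "?q ^ J = 1"
    proof -
      have "\<zeta> k ^ J = 1" for k
        using J unfolding \<zeta>_def by (intro complex_root_unity) simp
      thus ?thesis by (simp add: power_mult_distrib flip: complex_cnj_power)
    qed
    show ?thesis
    proof (cases "n = m")
      case True
      thus ?thesis using sum inv by simp
    next
      case False
      hence "\<zeta> n \<noteq> \<zeta> m"
        using complex_root_unity_eq[of J n m] J that unfolding \<zeta>_def by simp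
      hence "?q \<noteq> 1" using inv by (metis mult_cancel_right mult_zero_right zero_neq_one)
      thus ?thesis using sum \<open>?q ^ J = 1\<close> False by (simp add: sum_gp_strict)
    qed
  qed
  have "of_real (\<Sum>k<J. (norm (\<Sum>n<J. b n * \<zeta> k ^ n))\<^sup>2)
      = (\<Sum>k<J. (\<Sum>n<J. b n * \<zeta> k ^ n) * cnj (\<Sum>m<J. b m * \<zeta> k ^ m))"
    by (simp only: of_real_sum complex_norm_square)
  also have "\<dots> = (\<Sum>k<J. \<Sum>n<J. \<Sum>m<J. b n * cnj (b m) * (\<zeta> k ^ n * cnj (\<zeta> k ^ m)))"
    by (simp add: sum_product mult_ac)
  also have "\<dots> = (\<Sum>n<J. \<Sum>k<J. \<Sum>m<J. b n * cnj (b m) * (\<zeta> k ^ n * cnj (\<zeta> k ^ m)))"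
    by (rule sum.swap)
  also have "\<dots> = (\<Sum>n<J. \<Sum>m<J. \<Sum>k<J. b n * cnj (b m) * (\<zeta> k ^ n * cnj (\<zeta> k ^ m)))"
    by (intro sum.cong refl sum.swap)
  also have "\<dots> = (\<Sum>n<J. \<Sum>m<J. b n * cnj (b m) * (if n = m then of_nat J else 0))"
    unfolding sum_distrib_left[symmetric] by (intro sum.cong refl) (simp add: orth del: complex_cnj_power)
  also have "\<dots> = (\<Sum>n<J. \<Sum>m<J. if n = m then b n * cnj (b m) * of_nat J else 0)"
    by (intro sum.cong refl) simp
  also have "\<dots> = (\<Sum>n<J. b n * cnj (b n) * of_nat J)"
    by (intro sum.cong refl) (simp add: sum.delta')
  also have "\<dots> = of_real (real J * (\<Sum>n<J. (norm (b n))\<^sup>2))"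
    by (simp add: complex_norm_square sum_distrib_left mult_ac del: of_real_power)
  finally show ?thesis by (simp only: of_real_eq_iff)
qed

text \<open>
  Parseval's identity for the partial sums on a circle of radius \<open>r < 1\<close>, where they differ from the
  series by a tail that tends to 0; then \<open>r\<close> tends to 1.
\<close>

lemma bounded_fps_sum_norm_sq_le:
  fixes f :: "complex fps"
  assumes conv: "fps_conv_radius f \<ge> 1"
    and bound: "\<And>z. norm z < 1 \<Longrightarrow> norm (eval_fps f z) \<le> B"
  shows "(\<Sum>n<K. (norm (fps_nth f n))\<^sup>2) \<le> B\<^sup>2"
proof -
  have conv': "norm z < fps_conv_radius f" if "norm z < 1" for z :: complex
    using that conv by (meson ereal_less(3) less_le_trans)
  have inner: "(\<Sum>n<K. (norm (fps_nth f n) * r ^ n)\<^sup>2) \<le> B\<^sup>2" if r: "0 < r" "r < 1" for r :: real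
  proof -
    let ?b = "\<lambda>n. fps_nth f n * of_real r ^ n"
    define s where "s n = norm (?b n)" for n
    have s: "summable s"
      unfolding s_def using r by (intro norm_summable_fps conv') simp
    define tail where "tail J = suminf s - (\<Sum>n<J. s n)" for J
    have "tail \<longlonglongrightarrow> suminf s - suminf s"
      unfolding tail_def by (intro tendsto_intros summable_LIMSEQ s)
    hence tail_lim: "tail \<longlonglongrightarrow> 0" by simp
    have trunc: "norm (\<Sum>n<J. ?b n * \<omega> ^ n) \<le> B + tail J" if \<omega>: "norm \<omega> = 1" for J \<omega>
    proof -
      let ?z = "of_real r * \<omega>"
      let ?t = "\<lambda>n. fps_nth f n * ?z ^ n"
      have z: "norm ?z < 1" using r \<omega> by (simp add: norm_mult)
      have t: "norm (?t n) = s n" for n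
        using \<omega> by (simp add: s_def norm_mult norm_power power_mult_distrib)
      have summ: "summable ?t" by (rule summable_fps[OF conv'[OF z]])
      have summ_n: "summable (\<lambda>n. norm (?t (n + J)))"
        using s by (simp add: t summable_iff_shift)
      have "norm (suminf (\<lambda>n. ?t (n + J))) \<le> suminf (\<lambda>n. norm (?t (n + J)))"
        by (rule summable_norm[OF summ_n])
      also have "\<dots> = tail J"
        using suminf_minus_initial_segment[OF s, of J] by (simp only: t tail_def)
      finally have "norm (suminf (\<lambda>n. ?t (n + J))) \<le> tail J" .
      moreover have eq: "(\<Sum>n<J. ?t n) = eval_fps f ?z - suminf (\<lambda>n. ?t (n + J))"
        using suminf_minus_initial_segment[OF summ, of J] by (simp add: eval_fps_def)
      ultimately have "norm (\<Sum>n<J. ?t n) \<le> B + tail J"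
        unfolding eq using bound[OF z] norm_triangle_ineq4[of "eval_fps f ?z" "suminf (\<lambda>n. ?t (n + J))"] by linarith
      thus ?thesis by (simp add: power_mult_distrib mult.assoc)
    qed
    have le: "(\<Sum>n<K. (norm (?b n))\<^sup>2) \<le> (B + tail J)\<^sup>2" if J: "max 1 K \<le> J" for J
    proof -
      let ?\<zeta> = "\<lambda>k. exp (2 * of_real pi * \<i> * of_nat k / of_nat J) :: complex"
      have "real J * (\<Sum>n<K. (norm (?b n))\<^sup>2) \<le> real J * (\<Sum>n<J. (norm (?b n))\<^sup>2)"
        using J by (intro mult_left_mono sum_mono2) auto
      also have "\<dots> = (\<Sum>k<J. (norm (\<Sum>n<J. ?b n * ?\<zeta> k ^ n))\<^sup>2)"
        using J by (intro sum_norm_sq_roots_of_unity[symmetric]) simp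
      also have "\<dots> \<le> (\<Sum>k<J. (B + tail J)\<^sup>2)"
      proof (intro sum_mono power_mono norm_ge_zero)
        fix k
        have "norm (?\<zeta> k) = 1" by (simp add: norm_exp_eq_Re)
        thus "norm (\<Sum>n<J. ?b n * ?\<zeta> k ^ n) \<le> B + tail J" by (rule trunc)
      qed
      finally show ?thesis using J by simp
    qed
    have "(\<lambda>J. (B + tail J)\<^sup>2) \<longlonglongrightarrow> (B + 0)\<^sup>2" by (intro tendsto_intros tail_lim)
    moreover have "\<forall>\<^sub>F J in sequentially. (\<Sum>n<K. (norm (?b n))\<^sup>2) \<le> (B + tail J)\<^sup>2"
      using eventually_ge_at_top[of "max 1 K"] by (rule eventually_mono) (rule le)
    ultimately have "(\<Sum>n<K. (norm (?b n))\<^sup>2) \<le> (B + 0)\<^sup>2"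
      by (rule tendsto_lowerbound) simp
    thus ?thesis using r by (simp add: norm_mult norm_power)
  qed
  have "((\<lambda>r. \<Sum>n<K. (norm (fps_nth f n) * r ^ n)\<^sup>2) \<longlongrightarrow>
      (\<Sum>n<K. (norm (fps_nth f n) * 1 ^ n)\<^sup>2)) (at_left (1 :: real))"
    by (intro tendsto_intros)
  moreover have "\<forall>\<^sub>F r in at_left (1 :: real). (\<Sum>n<K. (norm (fps_nth f n) * r ^ n)\<^sup>2) \<le> B\<^sup>2"
    using eventually_at_left_real[of 0 "1 :: real"] by (rule eventually_mono) (auto intro: inner)
  ultimately have "(\<Sum>n<K. (norm (fps_nth f n) * 1 ^ n)\<^sup>2) \<le> B\<^sup>2"
    by (rule tendsto_upperbound) simp
  thus ?thesis by simp
qed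

section \<open>Algebraic power series with integer coefficients\<close>

text \<open>
  Clearing denominators turns an algebraic relation over \<open>\<rat>(t)\<close> into one over \<open>\<rat>[t]\<close>.
\<close>

lemma algebraic_fps_polynomial_relation:
  assumes "algebraic_fps f"
  shows "\<exists>Q :: rat poly poly. Q \<noteq> 0 \<and> (\<Sum>i\<le>degree Q. fps_of_poly (coeff Q i) * f ^ i) = 0"
proof -
  obtain P :: "rat poly fract poly"
    where P: "P \<noteq> 0" "poly (map_poly ratfun_to_fls P) (fps_to_fls f) = 0"
    using assms by (auto simp: algebraic_fps_def)
  obtain c Q where Q: "P = smult c (map_poly to_fract Q)"
    by (rule content_decompose_fract[of P])
  have nz: "ratfun_to_fls x \<noteq> 0" if "x \<noteq> 0" for x
    using ratfun_to_fls_mult[of x "inverse x"] that by auto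
  have c: "c \<noteq> 0" "Q \<noteq> 0" using P(1) Q by auto
  have "degree (map_poly ratfun_to_fls P) = degree Q"
    using c(1) nz Q by (simp add: degree_map_poly)
  moreover have "coeff (map_poly ratfun_to_fls P) i
      = ratfun_to_fls c * fps_to_fls (fps_of_poly (coeff Q i))" for i
  proof -
    have "coeff (map_poly to_fract Q) i = Fract (coeff Q i) 1"
      by (subst coeff_map_poly) (simp_all add: to_fract_def Zero_fract_def)
    thus ?thesis using ratfun_to_fls_Fract[of 1 "coeff Q i"]
      by (simp add: Q coeff_map_poly ratfun_to_fls_mult)
  qed
  ultimately have "0 = ratfun_to_fls c *
      (\<Sum>i\<le>degree Q. fps_to_fls (fps_of_poly (coeff Q i)) * fps_to_fls f ^ i)"
    using P(2) by (simp add: poly_altdef sum_distrib_left mult.assoc)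
  also have "(\<Sum>i\<le>degree Q. fps_to_fls (fps_of_poly (coeff Q i)) * fps_to_fls f ^ i)
      = fps_to_fls (\<Sum>i\<le>degree Q. fps_of_poly (coeff Q i) * f ^ i)"
  proof -
    have "fps_to_fls (\<Sum>i\<in>A. g i) = (\<Sum>i\<in>A. fps_to_fls (g i))" for A and g :: "nat \<Rightarrow> rat fps"
      by (induction A rule: infinite_finite_induct) simp_all
    thus ?thesis by (simp add: fls_times_fps_to_fls fps_to_fls_power)
  qed
  finally have "(\<Sum>i\<le>degree Q. fps_of_poly (coeff Q i) * f ^ i) = 0"
    using nz[OF c(1)] by simp
  thus ?thesis using c(2) by blast
qed

lemma rational_fpsI:
  assumes "q \<noteq> 0" "fps_of_poly q * f = fps_of_poly p"
  shows "rational_fps f"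
proof -
  have "fps_to_fls f * fps_to_fls (fps_of_poly q) = fps_to_fls (fps_of_poly p)"
    using assms(2) by (simp add: mult.commute flip: fls_times_fps_to_fls)
  hence "fps_to_fls f = ratfun_to_fls (Fract p q)"
    using assms(1) by (simp add: ratfun_to_fls_Fract nonzero_eq_divide_eq)
  thus ?thesis by (simp add: rational_fps_def)
qed

definition complex_fps :: "rat fps \<Rightarrow> complex fps" where
  "complex_fps f = Abs_fps (\<lambda>n. of_rat (fps_nth f n))"

lemma fps_nth_complex_fps [simp]: "fps_nth (complex_fps f) n = of_rat (fps_nth f n)"
  by (simp add: complex_fps_def)

lemma complex_fps_0: "complex_fps 0 = 0" and complex_fps_1: "complex_fps 1 = 1"
  by (simp_all add: fps_eq_iff)

lemma complex_fps_add: "complex_fps (f + g) = complex_fps f + complex_fps g"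
  by (simp add: fps_eq_iff of_rat_add)

lemma complex_fps_mult: "complex_fps (f * g) = complex_fps f * complex_fps g"
  by (simp add: fps_eq_iff fps_mult_nth of_rat_sum of_rat_mult)

lemma complex_fps_power: "complex_fps (f ^ n) = complex_fps f ^ n"
  by (induction n) (simp_all add: complex_fps_1 complex_fps_mult)

lemma complex_fps_sum: "complex_fps (sum g A) = (\<Sum>i\<in>A. complex_fps (g i))"
  by (induction A rule: infinite_finite_induct) (simp_all add: complex_fps_0 complex_fps_add)

lemma complex_fps_of_poly: "complex_fps (fps_of_poly p) = fps_of_poly (map_poly of_rat p)"
  by (simp add: fps_eq_iff coeff_map_poly)

lemma finite_support_of_bounded_square_sums:
  fixes a :: "nat \<Rightarrow> rat"
  assumes int: "\<And>n. a n \<in> \<int>" and bound: "\<And>K. (\<Sum>n<K. (norm (of_rat (a n) :: complex))\<^sup>2) \<le> B"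
  shows "finite {n. a n \<noteq> 0}"
proof (rule ccontr)
  assume "infinite {n. a n \<noteq> 0}"
  then obtain T where T: "T \<subseteq> {n. a n \<noteq> 0}" "finite T" "card T = Suc (nat \<lceil>B\<rceil>)"
    using infinite_arbitrarily_large by blast
  obtain K where K: "T \<subseteq> {..<K}" using finite_nat_iff_bounded T(2) by blast
  have ge1: "1 \<le> (norm (of_rat (a n) :: complex))\<^sup>2" if "n \<in> T" for n
  proof -
    obtain m where m: "a n = of_int m" using int by (metis Ints_cases)
    hence "m \<noteq> 0" using T(1) that by auto
    hence "1 \<le> \<bar>m\<bar>" by simp
    hence "1 \<le> \<bar>real_of_int m\<bar>" by linarith
    thus ?thesis using one_le_power[of "\<bar>real_of_int m\<bar>" 2] by (simp add: m)
  qed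
  have "real (card T) \<le> (\<Sum>n\<in>T. (norm (of_rat (a n) :: complex))\<^sup>2)"
    using sum_mono[of T "\<lambda>_. 1 :: real", OF ge1] by simp
  also have "\<dots> \<le> (\<Sum>n<K. (norm (of_rat (a n) :: complex))\<^sup>2)"
    using K by (intro sum_mono2) auto
  also have "\<dots> \<le> B" by (rule bound)
  finally show False using T(3) by linarith
qed

lemma common_denominator:
  assumes "finite (A :: rat set)"
  shows "\<exists>c :: rat. c \<noteq> 0 \<and> c \<in> \<int> \<and> (\<forall>x\<in>A. c * x \<in> \<int>)"
  using assms
proof induction
  case empty
  show ?case by (intro exI[of _ 1]) simp
next
  case (insert x A)
  then obtain c where c: "c \<noteq> 0" "c \<in> \<int>" "\<forall>x\<in>A. c * x \<in> \<int>" by blast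
  obtain a b :: int where x: "b > 0" "x = of_int a / of_int b"
    by (metis quotient_of_denom_pos quotient_of_div surj_pair)
  have "of_int b * x \<in> \<int>" using x by simp
  hence "c * (of_int b * x) \<in> \<int>" using c(2) by simp
  moreover have "of_int b * (c * y) \<in> \<int>" if "y \<in> A" for y using c(3) that by simp
  ultimately have "\<forall>y\<in>insert x A. (of_int b * c) * y \<in> \<int>" by (auto simp: mult_ac)
  moreover have "of_int b * c \<noteq> 0" "of_int b * c \<in> \<int>" using c x(1) by auto
  ultimately show ?case by blast
qed

text \<open>
  The product of a root with the leading coefficient is controlled by the coefficients alone, even
  where the leading coefficient is small and the root is large: for \<open>norm y > 1\<close>, solve the relation for the
  leading term and divide by the power \<open>D - 1\<close> of \<open>y\<close>.
\<close>

lemma leading_coeff_mult_root_bound: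
  fixes q :: "nat \<Rightarrow> complex"
  assumes rel: "(\<Sum>i\<le>D. q i * y ^ i) = 0" and D: "0 < D"
    and C: "\<And>i. i \<le> D \<Longrightarrow> norm (q i) \<le> C i"
  shows "norm (q D * y) \<le> (\<Sum>i\<le>D. C i)"
proof -
  have C0: "0 \<le> C i" if "i \<le> D" for i using C[OF that] norm_ge_zero order.trans by blast
  show ?thesis
  proof (cases "norm y \<le> 1")
    case True
    have "norm (q D * y) \<le> norm (q D)"
      using mult_left_mono[OF True, of "norm (q D)"] by (simp add: norm_mult)
    also have "\<dots> \<le> C D" using C by simp
    also have "\<dots> \<le> (\<Sum>i\<le>D. C i)" using C0 by (intro member_le_sum) auto
    finally show ?thesis .
  next
    case False
    have "(\<Sum>i\<le>D. q i * y ^ i) = (\<Sum>i<D. q i * y ^ i) + q D * y ^ D"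
      by (simp flip: lessThan_Suc_atMost)
    with rel have "q D * y ^ D = - (\<Sum>i<D. q i * y ^ i)"
      by (simp add: eq_neg_iff_add_eq_0 add.commute)
    hence "norm (q D * y ^ D) = norm (\<Sum>i<D. q i * y ^ i)" by simp
    also have "\<dots> \<le> (\<Sum>i<D. norm (q i * y ^ i))" by (rule norm_sum)
    also have "\<dots> \<le> (\<Sum>i<D. C i * norm y ^ (D - 1))"
    proof (rule sum_mono)
      fix i assume i: "i \<in> {..<D}"
      hence "norm y ^ i \<le> norm y ^ (D - 1)" using False by (intro power_increasing) auto
      thus "norm (q i * y ^ i) \<le> C i * norm y ^ (D - 1)"
        using i C[of i] C0[of i] by (simp add: norm_mult norm_power mult_mono)
    qed
    also have "\<dots> \<le> (\<Sum>i\<le>D. C i) * norm y ^ (D - 1)"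
      unfolding sum_distrib_right[symmetric]
      using C0 by (intro mult_right_mono sum_mono2) auto
    finally have "norm (q D * y ^ D) \<le> (\<Sum>i\<le>D. C i) * norm y ^ (D - 1)" .
    moreover have "norm (q D * y ^ D) = norm (q D * y) * norm y ^ (D - 1)"
      using D by (cases D) (simp_all add: norm_mult norm_power)
    ultimately have "norm (q D * y) * norm y ^ (D - 1) \<le> (\<Sum>i\<le>D. C i) * norm y ^ (D - 1)"
      by simp
    moreover have "0 < norm y ^ (D - 1)" using False by (intro zero_less_power) linarith
    ultimately show ?thesis by (rule mult_right_le_imp_le)
  qed
qed

lemma norm_poly_le_sum_norm_coeff:
  fixes p :: "complex poly"
  assumes "norm z \<le> 1"
  shows "norm (poly p z) \<le> (\<Sum>i\<le>degree p. norm (coeff p i))"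
proof -
  have "norm (poly p z) \<le> (\<Sum>i\<le>degree p. norm (coeff p i * z ^ i))"
    unfolding poly_altdef by (rule norm_sum)
  also have "\<dots> \<le> (\<Sum>i\<le>degree p. norm (coeff p i))"
    using assms by (intro sum_mono) (simp add: norm_mult norm_power mult_left_le power_le_one)
  finally show ?thesis .
qed

text \<open>
  The leading coefficient \<open>q\<close> of the relation, times a common denominator \<open>c\<close> of its own coefficients,
  makes \<open>g = c q f\<close> a series with integer coefficients that is bounded on the disc, hence a polynomial.
\<close>

theorem Fatou_algebraic_imp_rational:
  assumes int: "\<And>n. fps_nth f n \<in> \<int>" and conv: "fps_conv_radius (complex_fps f) \<ge> 1"
    and alg: "algebraic_fps f"
  shows "rational_fps f"
proof -
  obtain Q :: "rat poly poly" where Q: "Q \<noteq> 0"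
    and rel: "(\<Sum>i\<le>degree Q. fps_of_poly (coeff Q i) * f ^ i) = 0"
    using algebraic_fps_polynomial_relation[OF alg] by blast
  let ?F = "complex_fps f"
  define D where "D = degree Q"
  define q where "q i = map_poly (of_rat :: rat \<Rightarrow> complex) (coeff Q i)" for i
  have D: "0 < D"
  proof (rule ccontr)
    assume "\<not> 0 < D"
    hence "degree Q = 0" by (simp add: D_def)
    moreover from this rel have "coeff Q 0 = 0" by simp
    ultimately show False using Q leading_coeff_0_iff[of Q] by simp
  qed
  have conv_z: "norm z < fps_conv_radius ?F" if "norm z < 1" for z :: complex
    using that conv by (meson ereal_less(3) less_le_trans)
  have rel_z: "(\<Sum>i\<le>D. poly (q i) z * eval_fps ?F z ^ i) = 0" if z: "norm z < 1" for z
  proof -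
    note cz = conv_z[OF z]
    have pow: "norm z < fps_conv_radius (?F ^ i)" for i
      using cz fps_conv_radius_power[of ?F i] by (rule less_le_trans)
    have summand: "norm z < fps_conv_radius (fps_of_poly (q i) * ?F ^ i)" for i
      using pow[of i] fps_conv_radius_mult[of "fps_of_poly (q i)" "?F ^ i"]
      by (simp add: less_le_trans)
    have "0 = eval_fps (complex_fps (\<Sum>i\<le>D. fps_of_poly (coeff Q i) * f ^ i)) z"
      using rel by (simp add: D_def complex_fps_0)
    also have "\<dots> = eval_fps (\<Sum>i\<le>D. fps_of_poly (q i) * ?F ^ i) z"
      by (simp add: complex_fps_sum complex_fps_mult complex_fps_power complex_fps_of_poly q_def)
    also have "\<dots> = (\<Sum>i\<le>D. eval_fps (fps_of_poly (q i) * ?F ^ i) z)"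
    proof -
      have "(\<lambda>n. fps_nth (\<Sum>i\<le>D. fps_of_poly (q i) * ?F ^ i) n * z ^ n) sums
          (\<Sum>i\<le>D. eval_fps (fps_of_poly (q i) * ?F ^ i) z)"
        unfolding fps_sum_nth sum_distrib_right by (intro sums_sum sums_eval_fps summand)
      thus ?thesis unfolding eval_fps_def[of "sum _ _"] by (rule sums_unique[symmetric])
    qed
    also have "\<dots> = (\<Sum>i\<le>D. poly (q i) z * eval_fps ?F z ^ i)"
      using cz pow by (intro sum.cong refl) (simp add: eval_fps_mult eval_fps_power)
    finally show ?thesis by simp
  qed
  define B where "B = (\<Sum>i\<le>D. \<Sum>j\<le>degree (q i). norm (coeff (q i) j))"
  have bound: "norm (poly (q D) z * eval_fps ?F z) \<le> B" if z: "norm z < 1" for z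
    unfolding B_def using z
    by (intro leading_coeff_mult_root_bound rel_z D norm_poly_le_sum_norm_coeff) auto
  let ?p = "coeff Q D"
  obtain c :: rat where c: "c \<noteq> 0" "\<And>n. c * coeff ?p n \<in> \<int>"
  proof -
    have "range (coeff ?p) \<subseteq> insert 0 (coeff ?p ` {..degree ?p})"
    proof (rule image_subsetI)
      fix n
      show "coeff ?p n \<in> insert 0 (coeff ?p ` {..degree ?p})"
        by (cases "n \<le> degree ?p") (simp_all add: coeff_eq_0)
    qed
    hence "finite (range (coeff ?p))" by (rule finite_subset) simp
    thus thesis using that common_denominator by (metis rangeI)
  qed
  define g where "g = fps_of_poly (smult c ?p) * f"
  have g: "complex_fps g = fps_of_poly (smult (of_rat c) (q D)) * ?F"
    by (simp add: g_def q_def complex_fps_mult complex_fps_of_poly map_poly_smult of_rat_mult)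
  have g_int: "fps_nth g n \<in> \<int>" for n
    unfolding g_def fps_mult_nth using c int by (intro Ints_sum Ints_mult) simp_all
  have "(\<Sum>n<K. (norm (fps_nth (complex_fps g) n))\<^sup>2) \<le> (norm (of_rat c :: complex) * B)\<^sup>2" for K
  proof (rule bounded_fps_sum_norm_sq_le)
    show "1 \<le> fps_conv_radius (complex_fps g)"
      unfolding g using conv fps_conv_radius_mult[of "fps_of_poly (smult (of_rat c) (q D))" ?F]
      by (simp add: order.trans)
    show "norm (eval_fps (complex_fps g) z) \<le> norm (of_rat c :: complex) * B" if z: "norm z < 1" for z
      using mult_left_mono[OF bound[OF z], of "norm (of_rat c :: complex)"] conv_z[OF z]
      by (simp add: g eval_fps_mult norm_mult mult.assoc)
  qed
  hence "finite {n. fps_nth g n \<noteq> 0}"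
    by (intro finite_support_of_bounded_square_sums[of _ "(norm (of_rat c :: complex) * B)\<^sup>2"] g_int) simp
  then obtain K where "{n. fps_nth g n \<noteq> 0} \<subseteq> {..<K}" by (meson finite_nat_iff_bounded)
  hence "fps_of_poly (truncate_fps K g) = g" by (auto simp: fps_eq_iff)
  moreover have "smult c ?p \<noteq> 0" using c(1) Q by (simp add: D_def)
  ultimately show ?thesis
    by (intro rational_fpsI[of "smult c ?p" f "truncate_fps K g"]) (simp_all add: g_def)
qed

section \<open>Hilbert series\<close>

lemma polynomial_times_geometric_bounded: "\<exists>C. \<forall>N. real (N + 1) ^ E * (1 / 2) ^ N \<le> C"
proof -
  \<comment> \<open>This \<open>\<rho>\<close> splits \<open>1 / 2\<close> into enough factors to give each of the \<open>E\<close> linear factors its own.\<close>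
  define \<rho> :: real where "\<rho> = root (Suc E) (1 / 2)"
  have \<rho>: "0 < \<rho>" "\<rho> < 1" "\<rho> ^ Suc E = 1 / 2"
    unfolding \<rho>_def by (simp_all del: power_Suc)
  have "(\<lambda>N. real N * \<rho> ^ N + \<rho> ^ N) \<longlonglongrightarrow> 0 + 0"
    using \<rho> by (intro tendsto_add powser_times_n_limit_0 LIMSEQ_power_zero) simp_all
  hence "Bseq (\<lambda>N. real N * \<rho> ^ N + \<rho> ^ N)" by (rule convergentI[THEN convergent_imp_Bseq])
  then obtain K where K: "\<And>N. norm (real N * \<rho> ^ N + \<rho> ^ N) \<le> K" by (auto simp: Bseq_def)
  have "real (N + 1) ^ E * (1 / 2) ^ N \<le> K ^ E" for N
  proof -
    have le: "real (N + 1) * \<rho> ^ N \<le> K" using K[of N] \<rho>(1) by (simp add: algebra_simps)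
    have "(1 / 2) ^ N = \<rho> ^ (N * Suc E)"
      unfolding \<rho>(3)[symmetric] by (metis power_mult mult.commute)
    also have "\<dots> \<le> \<rho> ^ (N * E)" using \<rho> by (intro power_decreasing) auto
    finally have "real (N + 1) ^ E * (1 / 2) ^ N \<le> real (N + 1) ^ E * \<rho> ^ (N * E)"
      by (intro mult_left_mono) auto
    also have "\<dots> = (real (N + 1) * \<rho> ^ N) ^ E"
      by (simp only: power_mult_distrib power_mult)
    also have "\<dots> \<le> K ^ E" using le \<rho>(1) by (intro power_mono) auto
    finally show ?thesis .
  qed
  thus ?thesis by blast
qed

text \<open>
  Given \<open>s < 1\<close>, choose \<open>l\<close> with \<open>d * s ^ l < 1 / 2\<close>; then \<open>a n * s ^ n\<close> is at most a polynomial in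
  \<open>n div l\<close> divided by \<open>2 ^ (n div l)\<close>, hence bounded.
\<close>

lemma conv_radius_ge_1_if_subexponential:
  assumes d: "0 < d"
    and growth: "\<And>l. 0 < l \<Longrightarrow> \<exists>M. \<forall>n\<ge>l. a n \<le> d ^ (n div l) * (n div l + 1) ^ (d * M)"
  shows "conv_radius (\<lambda>n. of_nat (a n) :: complex) \<ge> 1"
proof (rule conv_radius_geI_ex')
  fix r :: real assume r: "0 < r" "ereal r < 1"
  hence "r < 1" by simp
  then obtain s where s: "r < s" "s < 1" using dense by blast
  have "(\<lambda>l. real d * s ^ l) \<longlonglongrightarrow> real d * 0"
    using r s by (intro tendsto_intros LIMSEQ_power_zero) simp
  hence "\<forall>\<^sub>F l in sequentially. real d * s ^ l < 1 / 2"
    by (rule order_tendstoD) simp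
  hence "\<forall>\<^sub>F l in sequentially. real d * s ^ l < 1 / 2 \<and> 0 < l"
    using eventually_gt_at_top by (rule eventually_conj)
  then obtain l where l: "real d * s ^ l < 1 / 2" "0 < l"
    using eventually_happens trivial_limit_sequentially by blast
  obtain M where M: "\<And>n. l \<le> n \<Longrightarrow> a n \<le> d ^ (n div l) * (n div l + 1) ^ (d * M)"
    using growth[OF l(2)] by blast
  obtain C where C: "\<And>N. real (N + 1) ^ (d * M) * (1 / 2) ^ N \<le> C"
    using polynomial_times_geometric_bounded by blast
  have "norm (of_nat (a n) :: complex) * s ^ n \<le> max C (\<Sum>k<l. real (a k))" for n
  proof (cases "n < l")
    case True
    have "real (a n) * s ^ n \<le> real (a n)"
      using r s by (intro mult_left_le power_le_one) auto
    also have "\<dots> \<le> (\<Sum>k<l. real (a k))" using True by (intro member_le_sum) auto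
    finally show ?thesis by simp
  next
    case False
    let ?N = "n div l"
    have "real (a n) * s ^ n \<le> (real d ^ ?N * real (?N + 1) ^ (d * M)) * s ^ (l * ?N)"
    proof (intro mult_mono)
      have "real (a n) \<le> real (d ^ ?N * (?N + 1) ^ (d * M))"
        using M[of n] False by (simp only: of_nat_le_iff)
      thus "real (a n) \<le> real d ^ ?N * real (?N + 1) ^ (d * M)" by simp
      show "s ^ n \<le> s ^ (l * ?N)" using r s by (intro power_decreasing) auto
    qed (use r s in auto)
    also have "\<dots> = real (?N + 1) ^ (d * M) * (real d * s ^ l) ^ ?N"
      by (simp add: power_mult_distrib power_mult mult_ac)
    also have "\<dots> \<le> real (?N + 1) ^ (d * M) * (1 / 2) ^ ?N"
      using r s l(1) by (intro mult_left_mono power_mono) auto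
    also have "\<dots> \<le> C" by (rule C)
    finally show ?thesis by simp
  qed
  hence "summable (\<lambda>n. norm (of_nat (a n) :: complex) * r ^ n)"
    using r s by (intro Abel_lemma[of r s]) auto
  hence "summable (\<lambda>n. norm ((of_nat (a n) :: complex) * of_real r ^ n))"
    using r by (simp add: norm_mult norm_power)
  thus "summable (\<lambda>n. (of_nat (a n) :: complex) * of_real r ^ n)" by (rule summable_norm_cancel)
qed

theorem theorem9:
  fixes scale :: "'k::field \<Rightarrow> 'a::ring \<Rightarrow> 'a"
    and R :: "nat \<Rightarrow> 'a set"
  assumes "graded_algebra scale R"
    and "graded_algebra.finitely_generated_in_degree_one scale R"
    and "associative_algebra.PI_algebra scale"
  shows "rational_fps (graded_algebra.Hilbert_series scale R) \<or>
         transcendental_fps (graded_algebra.Hilbert_series scale R)"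
proof -
  interpret graded_algebra scale R by (rule assms(1))
  obtain d where d: "0 < d"
    and growth: "\<And>l. 0 < l \<Longrightarrow>
      \<exists>M. \<forall>n\<ge>l. dim (R n) \<le> d ^ (n div l) * (n div l + 1) ^ (d * M)"
    using PI_growth[OF assms(2,3)] by blast
  have "fps_conv_radius (complex_fps Hilbert_series) \<ge> 1"
    using conv_radius_ge_1_if_subexponential[of d "\<lambda>n. dim (R n)", OF d growth]
    by (simp add: fps_conv_radius_def Hilbert_series_def)
  moreover have "fps_nth Hilbert_series n \<in> \<int>" for n
    by (simp add: Hilbert_series_def)
  ultimately show ?thesis
    using Fatou_algebraic_imp_rational by (auto simp: transcendental_fps_def)
qed

end
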